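(* Let $A\in\mathbb{R}^{m\times n}$ be an arbitrary matrix of rank $1$. For $j\in\{1,\dots,n\}$, let $\hat{a}\in\mathbb{R}^m$ denote column $j$ of $A$. Suppose that $j$ is chosen so that $\hat a$ is nonzero and $\|\hat{a}^+\|_1$ is minimum among all nonzero columns of $A$. Let $H\in\mathbb{R}^{n\times m}$ be the matrix with all rows equal to zero, except row $j$, which is given by $\hat{a}^+=(\hat a^\top\hat a)^{-1}\hat a^\top$. Then $H$ is an ah-symmetric reflexive generalized inverse of $A$ with minimum 1-norm; that is, $H$ is an ah-symmetric reflexive generalized inverse of $A$, and $\|H\|_1\le\|G\|_1$ for every ah-symmetric reflexive generalized inverse $G$ of $A$.
   Context: All matrices are real. A generalized inverse of $A\in\mathbb{R}^{m\times n}$ is a matrix $H\in\mathbb{R}^{n\times m}$ with $AHA=A$. It is called reflexive if in addition $HAH=H$, and ah-symmetric if in addition $AH$ is symmetric, i.e., $(AH)^\top=AH$. For a matrix $H$, $\|H\|_1:=\sum_{i,j}|h_{ij}|$ denotes the vector 1-norm of the entries of $H$ (not the induced operator norm). $A^+$ denotes the Moore-Penrose pseudoinverse of $A$; for a matrix $\hat A$ of full column rank, $\hat A^+=(\hat A^\top\hat A)^{-1}\hat A^\top$. *)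

theory Defs
  imports "HOL-Analysis.Analysis"
begin

definition generalized_inverse :: "real^'n^'m \<Rightarrow> real^'m^'n \<Rightarrow> bool" where
  "generalized_inverse A H \<longleftrightarrow> A ** H ** A = A"

definition reflexive_ginv :: "real^'n^'m \<Rightarrow> real^'m^'n \<Rightarrow> bool" where
  "reflexive_ginv A H \<longleftrightarrow> generalized_inverse A H \<and> H ** A ** H = H"

definition ah_symmetric_ginv :: "real^'n^'m \<Rightarrow> real^'m^'n \<Rightarrow> bool" where
  "ah_symmetric_ginv A H \<longleftrightarrow> generalized_inverse A H \<and> transpose (A ** H) = A ** H"

definition ah_symmetric_reflexive_ginv :: "real^'n^'m \<Rightarrow> real^'m^'n \<Rightarrow> bool" where
  "ah_symmetric_reflexive_ginv A H \<longleftrightarrow> ah_symmetric_ginv A H \<and> reflexive_ginv A H"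

text \<open>The entrywise 1-norm, not the induced operator norm.\<close>

definition norm1 :: "real^'n^'m \<Rightarrow> real" where
  "norm1 H = (\<Sum>i\<in>UNIV. \<Sum>j\<in>UNIV. \<bar>H $ i $ j\<bar>)"

definition is_pseudoinverse :: "real^'n^'m \<Rightarrow> real^'m^'n \<Rightarrow> bool" where
  "is_pseudoinverse A X \<longleftrightarrow>
     A ** X ** A = A \<and> X ** A ** X = X \<and>
     transpose (A ** X) = A ** X \<and> transpose (X ** A) = X ** A"

definition pseudoinverse :: "real^'n^'m \<Rightarrow> real^'m^'n" where
  "pseudoinverse A = (THE X. is_pseudoinverse A X)"

text \<open>Column \<open>j\<close> of a matrix, regarded as an \<open>m \<times> 1\<close> matrix, so that
  its pseudoinverse is a \<open>1 \<times> m\<close> matrix.\<close>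

definition column_mat :: "'n \<Rightarrow> real^'n^'m \<Rightarrow> real^1^'m" where
  "column_mat j A = columnvector (column j A)"

lemma is_pseudoinverse_unique:
  assumes X: "is_pseudoinverse A X" and Y: "is_pseudoinverse A Y"
  shows "X = Y"
proof -
  have 1: "A ** X = A ** Y"
  proof -
    have "A ** X = transpose ((A ** Y) ** (A ** X))"
      using X Y by (simp add: is_pseudoinverse_def matrix_mul_assoc)
    also have "\<dots> = (A ** X) ** (A ** Y)"
      using X Y by (simp add: is_pseudoinverse_def matrix_transpose_mul)
    also have "\<dots> = A ** Y"
      using X by (simp add: is_pseudoinverse_def matrix_mul_assoc)
    finally show ?thesis .
  qed
  have 2: "X ** A = Y ** A"
  proof -
    have "X ** A = transpose ((X ** A) ** (Y ** A))"
    proof -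
      have "(X ** A) ** (Y ** A) = X ** (A ** Y ** A)"
        by (simp add: matrix_mul_assoc)
      then show ?thesis
        using X Y by (simp add: is_pseudoinverse_def)
    qed
    also have "\<dots> = (Y ** A) ** (X ** A)"
      using X Y by (simp add: is_pseudoinverse_def matrix_transpose_mul)
    also have "\<dots> = Y ** (A ** X ** A)"
      by (simp add: matrix_mul_assoc)
    also have "\<dots> = Y ** A"
      using X by (simp add: is_pseudoinverse_def)
    finally show ?thesis .
  qed
  have "X = (X ** A) ** X" using X by (simp add: is_pseudoinverse_def)
  also have "\<dots> = Y ** (A ** X)" by (simp add: 2 matrix_mul_assoc)
  also have "\<dots> = Y ** A ** Y" by (simp add: 1 matrix_mul_assoc)
  also have "\<dots> = Y" using Y by (simp add: is_pseudoinverse_def)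
  finally show ?thesis .
qed

lemma pseudoinverse_eqI: "is_pseudoinverse A X \<Longrightarrow> pseudoinverse A = X"
  unfolding pseudoinverse_def by (blast intro: is_pseudoinverse_unique the_equality)

lemma pseudoinverse_full_column_rank:
  fixes A :: "real^'n^'m"
  assumes "rank A = CARD('n)"
  shows "is_pseudoinverse A (matrix_inv (transpose A ** A) ** transpose A)"
    and "pseudoinverse A = matrix_inv (transpose A ** A) ** transpose A"
proof -
  let ?G = "transpose A ** A"
  let ?B = "matrix_inv ?G"
  have inj: "inj ((*v) A)"
    using assms full_rank_injective by blast
  have "x = 0" if "?G *v x = 0" for x
  proof -
    have "(A *v x) \<bullet> (A *v x) = x \<bullet> (?G *v x)"
      by (metis dot_lmul_matrix inner_commute matrix_vector_mul_assoc transpose_matrix_vector)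
    then have "A *v x = 0" using that by simp
    then show ?thesis using inj by (metis injD matrix_vector_mult_0_right)
  qed
  then have inv: "invertible ?G"
    using invertible_left_inverse matrix_left_invertible_ker by blast
  then have BG: "?B ** ?G = mat 1" and GB: "?G ** ?B = mat 1"
    using someI_ex[OF inv[unfolded invertible_def]] by (simp_all add: matrix_inv_def)
  have GT: "transpose ?G = ?G" by (simp add: matrix_transpose_mul)
  have "transpose ?B ** ?G = mat 1"
    by (metis GB GT matrix_transpose_mul transpose_mat)
  then have BT: "transpose ?B = ?B"
    by (metis GB matrix_mul_assoc matrix_mul_lid matrix_mul_rid)
  have XA: "?B ** transpose A ** A = mat 1"
    using BG by (simp add: matrix_mul_assoc)
  show *: "is_pseudoinverse A (?B ** transpose A)"
    unfolding is_pseudoinverse_def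
  proof (intro conjI)
    show "A ** (?B ** transpose A) ** A = A"
      by (metis XA matrix_mul_assoc matrix_mul_rid)
    show "?B ** transpose A ** A ** (?B ** transpose A) = ?B ** transpose A"
      by (simp add: XA)
    show "transpose (A ** (?B ** transpose A)) = A ** (?B ** transpose A)"
      by (simp add: matrix_transpose_mul BT matrix_mul_assoc)
    show "transpose (?B ** transpose A ** A) = ?B ** transpose A ** A"
      by (simp add: XA transpose_mat)
  qed
  show "pseudoinverse A = ?B ** transpose A"
    by (rule pseudoinverse_eqI[OF *])
qed

lemma rank_column_mat:
  assumes "column j A \<noteq> 0"
  shows "rank (column_mat j A) = CARD(1)"
proof -
  have "column_mat j A \<noteq> 0"
    using assms by (auto simp: column_mat_def columnvector_def vec_eq_iff)
  then have "rank (column_mat j A) \<noteq> 0" by (simp add: rank_eq_0)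
  moreover have "rank (column_mat j A) \<le> CARD(1)"
    using rank_bound[of "column_mat j A"] by simp
  ultimately show ?thesis by simp
qed

end

theory Submission
  imports Defs
begin

text \<open>
  Write \<open>A = a v\<^sup>T\<close> with \<open>a\<close> the chosen column, so that \<open>v\<^sub>j = 1\<close>.  For every ah-symmetric
  generalized inverse \<open>G\<close> the matrix \<open>A G = a (v\<^sup>T G)\<close> is symmetric and fixes \<open>a\<close>, which forces
  \<open>v\<^sup>T G = a\<^sup>T / (a \<bullet> a)\<close>.  The minimality of \<open>j\<close> says that \<open>\<bar>v\<^sub>k\<bar> \<le> 1\<close> for all \<open>k\<close>, and the
  triangle inequality in each column of \<open>G\<close> then bounds its norm from below by that of
  \<open>a\<^sup>T / (a \<bullet> a)\<close>.
\<close>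

text \<open>The index \<open>i\<close> ranges over the one-element type \<open>1\<close>, so the
  right-hand side is a single row. This row is a left inverse of the column, and the product in the
  other order is a multiple of the symmetric matrix of entries \<open>a $ i * a $ l\<close>; the
  Penrose conditions follow.\<close>

lemma pseudoinverse_columnvector:
  fixes a :: "real^'m"
  assumes "a \<noteq> 0"
  shows "pseudoinverse (columnvector a :: real^1^'m) = (\<chi> i. (1 / (a \<bullet> a)) *\<^sub>R a)"
proof (rule pseudoinverse_eqI)
  let ?C = "columnvector a :: real^1^'m"
  let ?X = "(\<chi> i. (1 / (a \<bullet> a)) *\<^sub>R a) :: real^'m^1"
  have "?X ** ?C = mat 1"
    using assms
    by (simp add: vec_eq_iff matrix_matrix_mult_def columnvector_def mat_def
        sum_divide_distrib[symmetric] inner_vec_def[of a a, simplified, symmetric])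
  then show "is_pseudoinverse ?C ?X"
    unfolding is_pseudoinverse_def
    by (simp add: matrix_mul_assoc[symmetric])
      (simp add: vec_eq_iff matrix_matrix_mult_def columnvector_def transpose_def mat_def mult.commute)
qed

text \<open>Turns the minimality of the chosen column into a bound on the coefficients of the
  others: a longer multiple of \<open>a\<close> has a smaller pseudoinverse.\<close>

lemma norm1_pseudoinverse_columnvector_scaleR:
  fixes a :: "real^'m"
  assumes "a \<noteq> 0" "c \<noteq> 0"
  shows "norm1 (pseudoinverse (columnvector (c *\<^sub>R a) :: real^1^'m)) =
    norm1 (pseudoinverse (columnvector a :: real^1^'m)) / \<bar>c\<bar>"
  using assms
  by (simp add: pseudoinverse_columnvector norm1_def sum_divide_distrib abs_mult ac_simps)

text \<open>A nonzero column is an independent set whose size is already the dimension of the column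
  space, so it spans all columns.\<close>

lemma rank_1_column_multiple:
  fixes A :: "real^'n^'m"
  assumes "rank A = 1" "column j A \<noteq> 0"
  obtains v where "\<And>k. column k A = v k *\<^sub>R column j A"
proof -
  have "columns A \<subseteq> span {column j A}"
  proof (rule card_ge_dim_independent)
    show "{column j A} \<subseteq> columns A" by (auto simp: columns_def)
    show "independent {column j A}" using assms by simp
    show "dim (columns A) \<le> card {column j A}"
      using assms by (simp add: column_rank_def)
  qed
  then have "\<forall>k. \<exists>c. column k A = c *\<^sub>R column j A"
    by (fastforce simp: span_singleton columns_def)
  then show ?thesis using that by metis
qed

lemma ah_symmetric_ginv_outer_product:
  fixes A :: "real^'n^'m" and G :: "real^'m^'n"
  assumes G: "ah_symmetric_ginv A G"
    and A: "\<And>i k. A $ i $ k = v k * a $ i" and "v j = 1" and "a \<noteq> 0"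
  shows "(\<Sum>k\<in>UNIV. v k * G $ k $ l) = a $ l / (a \<bullet> a)"
proof -
  define w where "w l = (\<Sum>k\<in>UNIV. v k * G $ k $ l)" for l
  have AG: "(A ** G) $ i $ l = a $ i * w l" for i l
    by (simp add: matrix_matrix_mult_def A w_def sum_distrib_left ac_simps)
  have sym: "a $ i * w l = a $ l * w i" for i l
  proof -
    have "transpose (A ** G) $ l $ i = (A ** G) $ l $ i"
      using G by (simp add: ah_symmetric_ginv_def)
    then show ?thesis by (simp add: transpose_def AG)
  qed
  have wa: "(\<Sum>i\<in>UNIV. w i * a $ i) = 1"
  proof -
    obtain i where i: "a $ i \<noteq> 0" using \<open>a \<noteq> 0\<close> by (auto simp: vec_eq_iff)
    \<comment> \<open>Column \<open>j\<close> is read off because it equals \<open>a\<close>: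
      \<open>A ** G\<close> must fix \<open>a\<close>, and a nonzero entry of \<open>a\<close> can
      be cancelled.\<close>
    have "(A ** G ** A) $ i $ j = a $ i * (\<Sum>i\<in>UNIV. w i * a $ i)"
      unfolding matrix_matrix_mult_def[of "A ** G"]
      by (simp add: AG A \<open>v j = 1\<close> sum_distrib_left ac_simps)
    also have "(A ** G ** A) $ i $ j = a $ i"
      using G by (simp add: ah_symmetric_ginv_def generalized_inverse_def A \<open>v j = 1\<close>)
    finally show ?thesis using i by simp
  qed
  \<comment> \<open>Splitting off one factor \<open>a $ i\<close> exposes
    \<open>a $ i * w l\<close>, where symmetry moves the index \<open>l\<close> from
    \<open>w\<close> to \<open>a\<close>.\<close>
  have "w l * (a \<bullet> a) = (\<Sum>i\<in>UNIV. a $ i * (a $ i * w l))"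
    by (simp add: inner_vec_def sum_distrib_left ac_simps)
  also have "\<dots> = a $ l * (\<Sum>i\<in>UNIV. w i * a $ i)"
    unfolding sym[of _ l] by (simp add: sum_distrib_left ac_simps)
  finally have "a $ l = w l * (a \<bullet> a)" by (simp add: wa)
  then show ?thesis using \<open>a \<noteq> 0\<close> by (simp add: w_def)
qed

theorem theorem6:
  fixes A :: "real^'n^'m" and H :: "real^'m^'n" and j :: 'n
  assumes "rank A = 1"
    and "column j A \<noteq> 0"
    and "\<And>k. column k A \<noteq> 0 \<Longrightarrow>
           norm1 (pseudoinverse (column_mat j A)) \<le> norm1 (pseudoinverse (column_mat k A))"
    and "H = (\<chi> i. if i = j then row 1 (pseudoinverse (column_mat j A)) else 0)"
  shows "ah_symmetric_reflexive_ginv A H \<and>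
         (\<forall>G. ah_symmetric_reflexive_ginv A G \<longrightarrow> norm1 H \<le> norm1 G)"
proof -
  define a where "a = column j A"
  have a0: "a \<noteq> 0" using assms by (simp add: a_def)
  obtain v where v: "\<And>k. column k A = v k *\<^sub>R a"
    using rank_1_column_multiple[OF assms(1,2)] unfolding a_def by metis
  have A: "A $ i $ k = v k * a $ i" for i k
    using arg_cong[OF v, of "\<lambda>x. x $ i" k] by (simp add: column_def)
  have vj: "v j = 1"
    using v[of j] a0 scaleR_cancel_right[of 1 a "v j"] by (simp flip: a_def)
  have H: "H $ k $ l = (if k = j then a $ l / (a \<bullet> a) else 0)" for k l
    using a0 by (simp add: assms(4) column_mat_def row_def pseudoinverse_columnvector flip: a_def)
  have AH: "(A ** H) $ i $ l = a $ i * a $ l / (a \<bullet> a)" for i l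
    by (simp add: matrix_matrix_mult_def H A vj if_distrib cong: if_cong)
  have aa: "(\<Sum>i\<in>UNIV. a $ i * a $ i) = a \<bullet> a" "a \<bullet> a \<noteq> 0"
    using a0 by (simp add: inner_vec_def) (use a0 in simp)
  have AHA: "A ** H ** A = A"
  proof -
    have "(A ** H ** A) $ i $ k = v k * a $ i * (\<Sum>i\<in>UNIV. a $ i * a $ i) / (a \<bullet> a)" for i k
      unfolding matrix_matrix_mult_def[of "A ** H"]
      by (simp add: AH A sum_distrib_left sum_divide_distrib ac_simps)
    then show ?thesis using aa by (simp add: vec_eq_iff A)
  qed
  have HAH: "H ** (A ** H) = H"
  proof -
    have "(H ** (A ** H)) $ k $ l =
      (if k = j then a $ l * (\<Sum>i\<in>UNIV. a $ i * a $ i) / ((a \<bullet> a) * (a \<bullet> a)) else 0)" for k l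
      unfolding matrix_matrix_mult_def[of H]
      by (simp add: AH H sum_distrib_left sum_divide_distrib ac_simps)
    then show ?thesis using aa by (simp add: vec_eq_iff H)
  qed
  have "transpose (A ** H) = A ** H"
    by (simp add: vec_eq_iff transpose_def AH)
  then have "ah_symmetric_reflexive_ginv A H"
    using AHA HAH
    by (simp add: ah_symmetric_reflexive_ginv_def ah_symmetric_ginv_def reflexive_ginv_def
        generalized_inverse_def matrix_mul_assoc)
  moreover have "norm1 H \<le> norm1 G" if G: "ah_symmetric_reflexive_ginv A G" for G
  proof -
    let ?N = "norm1 (pseudoinverse (columnvector a :: real^1^'m))"
    have N: "?N = (\<Sum>l\<in>UNIV. \<bar>a $ l / (a \<bullet> a)\<bar>)"
      using a0 by (simp add: norm1_def pseudoinverse_columnvector)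
    obtain i where "a $ i \<noteq> 0" using a0 by (auto simp: vec_eq_iff)
    then have Npos: "?N > 0"
      using a0 unfolding N by (intro sum_pos2[of _ i]) auto
    \<comment> \<open>Minimality speaks only of nonzero columns, hence the case split; a zero column
      has \<open>v k = 0\<close>. Otherwise the positive \<open>?N\<close> cancels.\<close>
    have v_le: "\<bar>v k\<bar> \<le> 1" for k
    proof (cases "v k = 0")
      case False
      then have "?N \<le> ?N / \<bar>v k\<bar>"
        using assms(3)[of k] a0
        by (simp add: column_mat_def v norm1_pseudoinverse_columnvector_scaleR vj)
      then show ?thesis using False Npos by (simp add: field_simps)
    qed simp
    \<comment> \<open>Summing by columns first leaves one term for each \<open>l\<close>, since only
      row \<open>j\<close> of \<open>H\<close> can be nonzero.\<close>
    have "norm1 H = (\<Sum>l\<in>UNIV. \<bar>a $ l / (a \<bullet> a)\<bar>)"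
      unfolding norm1_def by (subst sum.swap) (simp add: H if_distrib cong: if_cong)
    also have "\<dots> = (\<Sum>l\<in>UNIV. \<bar>\<Sum>k\<in>UNIV. v k * G $ k $ l\<bar>)"
      using G ah_symmetric_ginv_outer_product[OF _ A vj a0]
      by (simp add: ah_symmetric_reflexive_ginv_def)
    also have "\<dots> \<le> (\<Sum>l\<in>UNIV. \<Sum>k\<in>UNIV. \<bar>G $ k $ l\<bar>)"
      by (intro sum_mono order_trans[OF sum_abs])
        (simp add: abs_mult mult_left_le_one_le v_le)
    also have "\<dots> = norm1 G"
      unfolding norm1_def by (rule sum.swap)
    finally show ?thesis .
  qed
  ultimately show ?thesis by blast
qed

end
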